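(* Let $\mathcal{E}$ be a non-trivial $3$-dimensional Volterra evolution algebra over a field $\mathbb{K}$ of characteristic zero. Up to isomorphism, $\mathcal{E}$ has a natural basis $\{e_1,e_2,e_3\}$ and structural matrix $A_{\mathcal{E}}=(a_{ij})$ falling into one of the following three cases, and in each case the derivations of $\mathcal{E}$ and the dimension of the annihilator are as follows, where a derivation $D$ is represented by the matrix $(d_{ij})$ with $D(e_i)=\sum_{j=1}^3 d_{ij}e_j$. (1) The graph is complete, i.e. $a_{12},a_{13},a_{23}$ are all nonzero. Then every derivation of $\mathcal{E}$ is trivial (zero), and $\dim\operatorname{ann}(\mathcal{E})=0$. (2) Exactly the pairs of vertices $\{1,2\}$ and $\{1,3\}$ are connected in the graph, with $$A_{\mathcal{E}}=\begin{pmatrix}0&1&a\\-1&0&0\\-a&0&0\end{pmatrix},\qquad a\neq 0.$$ Then either the derivations of $\mathcal{E}$ are given by the matrices $$\begin{pmatrix}2\alpha&0&0\\0&\alpha&3a\alpha\\0&-3a^2\alpha&\alpha\end{pmatrix},\qquad \alpha\in\mathbb{K},$$ or every derivation of $\mathcal{E}$ is trivial; and $\dim\operatorname{ann}(\mathcal{E})=0$. (3) Only the pair of vertices $\{1,2\}$ is connected in the graph, with $a_{12}=1$ and $a_{13}=a_{23}=0$. Then the derivations of $\mathcal{E}$ are given by the matrices $$\begin{pmatrix}0&0&0\\0&0&0\\0&0&\alpha\end{pmatrix},\qquad \alpha\in\mathbb{K},$$ and $\dim\operatorname{ann}(\mathcal{E})=1$.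
   Context: An evolution algebra over $\mathbb{K}$ is a finite-dimensional $\mathbb{K}$-vector space $\mathcal{E}$ with a bilinear multiplication and a basis $\{e_1,\dots,e_n\}$ (called a natural basis) such that $e_ie_j=0$ for $i\neq j$ and $e_i^2=\sum_{k=1}^n a_{ik}e_k$. The matrix $A_{\mathcal{E}}=(a_{ij})_{i,j=1}^n$ is the structural matrix of $\mathcal{E}$ in this natural basis. The evolution algebra is called a Volterra evolution algebra if $A_{\mathcal{E}}$ is skew-symmetric. It is non-trivial if $A_{\mathcal{E}}\neq 0$. The weighted graph attached to $\mathcal{E}$ relative to the natural basis has vertex set $\{1,\dots,n\}$, edge set $E=\{(i,j): a_{ij}\neq 0\}$ and weights $\omega((i,j))=a_{ij}$; two vertices $i\ne j$ are connected if $a_{ij}\neq 0$ (equivalently $a_{ji}\neq 0$). A derivation of $\mathcal{E}$ is a linear map $D:\mathcal{E}\to\mathcal{E}$ with $D(uv)=D(u)v+uD(v)$ for all $u,v\in\mathcal{E}$. The annihilator is $\operatorname{ann}(\mathcal{E})=\{x\in\mathcal{E}: x\mathcal{E}=\mathcal{E}x=0\}$. *)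

theory Defs
  imports "HOL-Analysis.Analysis"
begin

locale nonassoc_algebra = vector_space scale
  for scale :: "'k::field \<Rightarrow> 'v::ab_group_add \<Rightarrow> 'v" (infixr \<open>*s\<close> 75) +
  fixes mult :: "'v \<Rightarrow> 'v \<Rightarrow> 'v" (infixl \<open>\<bullet>\<^sub>E\<close> 70)
  assumes linear_mult_left: "Vector_Spaces.linear scale scale (\<lambda>u. u \<bullet>\<^sub>E v)"
    and linear_mult_right: "Vector_Spaces.linear scale scale (\<lambda>v. u \<bullet>\<^sub>E v)"
begin

definition derivation :: "('v \<Rightarrow> 'v) \<Rightarrow> bool" where
  "derivation D \<longleftrightarrow> Vector_Spaces.linear scale scale D \<and>
     (\<forall>u v. D (u \<bullet>\<^sub>E v) = D u \<bullet>\<^sub>E v + u \<bullet>\<^sub>E D v)"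

definition annihilator :: "'v set" where
  "annihilator = {x. \<forall>y. x \<bullet>\<^sub>E y = 0 \<and> y \<bullet>\<^sub>E x = 0}"

definition natural_basis :: "('n::finite \<Rightarrow> 'v) \<Rightarrow> bool" where
  "natural_basis e \<longleftrightarrow> inj e \<and> independent (range e) \<and> span (range e) = UNIV \<and>
     (\<forall>i j. i \<noteq> j \<longrightarrow> e i \<bullet>\<^sub>E e j = 0)"

text \<open>The basis is a family indexed by a finite type. Row \<open>i\<close> of the matrix of a map holds the
  coordinates of the image of \<open>e i\<close>, so a map corresponds to the transpose of its usual
  column matrix.\<close>

definition map_matrix :: "('n::finite \<Rightarrow> 'v) \<Rightarrow> ('v \<Rightarrow> 'v) \<Rightarrow> 'k^'n^'n" where
  "map_matrix e D = (\<chi> i j. representation (range e) (D (e i)) (e j))"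

definition structural_matrix :: "('n::finite \<Rightarrow> 'v) \<Rightarrow> 'k^'n^'n" where
  "structural_matrix e = (\<chi> i k. representation (range e) (e i \<bullet>\<^sub>E e i) (e k))"

lemma sum_basis_coordinates:
  fixes e :: "'n::finite \<Rightarrow> 'v"
  assumes "natural_basis e"
  shows "(\<Sum>k\<in>UNIV. representation (range e) v (e k) *s e k) = v"
proof -
  have "(\<Sum>b\<in>range e. representation (range e) v b *s b) = v"
    using assms by (intro sum_representation_eq) (auto simp: natural_basis_def)
  moreover have "inj e"
    using assms by (simp add: natural_basis_def)
  ultimately show ?thesis
    by (simp add: sum.reindex)
qed

lemma natural_basis_square:
  fixes e :: "'n::finite \<Rightarrow> 'v"
  assumes "natural_basis e"
  shows "e i \<bullet>\<^sub>E e i = (\<Sum>k\<in>UNIV. structural_matrix e $ i $ k *s e k)"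
  using sum_basis_coordinates[OF assms] by (simp add: structural_matrix_def)

lemma map_matrix_apply:
  fixes e :: "'n::finite \<Rightarrow> 'v"
  assumes "natural_basis e"
  shows "D (e i) = (\<Sum>j\<in>UNIV. map_matrix e D $ i $ j *s e j)"
  using sum_basis_coordinates[OF assms] by (simp add: map_matrix_def)

end

text \<open>A natural basis is part of the data, since the structural matrix and the graph depend on it.
  The dimension is the cardinality of the index type.\<close>

locale evolution_algebra = nonassoc_algebra scale mult
  for scale :: "'k::field \<Rightarrow> 'v::ab_group_add \<Rightarrow> 'v" (infixr \<open>*s\<close> 75)
    and mult :: "'v \<Rightarrow> 'v \<Rightarrow> 'v" (infixl \<open>\<bullet>\<^sub>E\<close> 70) +
  fixes e :: "'n::finite \<Rightarrow> 'v"
  assumes natural_basis: "natural_basis e"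

locale volterra_evolution_algebra = evolution_algebra scale mult e
  for scale :: "'k::field \<Rightarrow> 'v::ab_group_add \<Rightarrow> 'v" (infixr \<open>*s\<close> 75)
    and mult :: "'v \<Rightarrow> 'v \<Rightarrow> 'v" (infixl \<open>\<bullet>\<^sub>E\<close> 70)
    and e :: "'n::finite \<Rightarrow> 'v" +
  assumes skew_symmetric: "transpose (structural_matrix e) = - structural_matrix e"

definition graph_edges :: "'k::zero^'n^'n \<Rightarrow> ('n \<times> 'n) set" where
  "graph_edges A = {(i, j). A $ i $ j \<noteq> 0}"

definition connected_pairs :: "'k::zero^'n^'n \<Rightarrow> 'n set set" where
  "connected_pairs A = {{i, j} | i j. i \<noteq> j \<and> (i, j) \<in> graph_edges A}"

definition complete_graph :: "'k::zero^'n^'n \<Rightarrow> bool" where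
  "complete_graph A \<longleftrightarrow> (\<forall>i j. i \<noteq> j \<longrightarrow> {i, j} \<in> connected_pairs A)"

lemma complete_graph_3_iff:
  fixes A :: "'k::field^3^3"
  assumes "transpose A = - A"
  shows "complete_graph A \<longleftrightarrow> A $ 1 $ 2 \<noteq> 0 \<and> A $ 1 $ 3 \<noteq> 0 \<and> A $ 2 $ 3 \<noteq> 0"
proof -
  have *: "A $ j $ i = 0 \<longleftrightarrow> A $ i $ j = 0" for i j
    using arg_cong[OF assms, of "\<lambda>M. M $ i $ j"] by (simp add: transpose_def)
  have "{i, j} \<in> connected_pairs A \<longleftrightarrow> i \<noteq> j \<and> A $ i $ j \<noteq> 0" for i j
    unfolding connected_pairs_def graph_edges_def mem_Collect_eq prod.case doubleton_eq_iff
    using *[of i j] by blast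
  then show ?thesis
    unfolding complete_graph_def forall_3
    using *[of 1 2] *[of 1 3] *[of 2 3] by auto
qed

text \<open>The three normal forms of a structural matrix; each is meant for a skew-symmetric \<open>A\<close>,
  so the third one leaves the entries below the diagonal implicit.\<close>

definition volterra_case1 :: "'k::field^3^3 \<Rightarrow> bool" where
  "volterra_case1 A \<longleftrightarrow> complete_graph A"

definition volterra_case2 :: "'k::field \<Rightarrow> 'k^3^3 \<Rightarrow> bool" where
  "volterra_case2 a A \<longleftrightarrow> connected_pairs A = {{1, 2}, {1, 3}} \<and> a \<noteq> 0 \<and>
     A = vector [vector [ 0, 1, a],
                 vector [-1, 0, 0],
                 vector [-a, 0, 0]]"

definition volterra_case3 :: "'k::field^3^3 \<Rightarrow> bool" where
  "volterra_case3 A \<longleftrightarrow> connected_pairs A = {{1, 2}} \<and>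
     A $ 1 $ 2 = 1 \<and> A $ 1 $ 3 = 0 \<and> A $ 2 $ 3 = 0"

end

theory Submission
  imports Defs
begin

text \<open>In coordinates the Leibniz rule becomes a system of equations in the entries of the structural
  matrix and of the matrix of \<open>D\<close>, so each of the three cases is solved by elimination. Likewise
  the annihilator is spanned by the basis vectors whose row in the structural matrix vanishes.
  The normal form is reached by a transposition of the basis followed by a uniform rescaling.\<close>

section \<open>Bilinear products and coordinates in a natural basis\<close>

lemmas linear_map_add = module_hom.add[OF Vector_Spaces.module_hom_linearI]
lemmas linear_map_scale = module_hom.scale[OF Vector_Spaces.module_hom_linearI]
lemmas linear_map_sum = module_hom.sum[OF Vector_Spaces.module_hom_linearI]

no_notation vector_scalar_mult (infixl \<open>*s\<close> 70)

text \<open>The coordinates of the Leibniz rule on basis vectors, with row \<open>i\<close> of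
  \<open>M\<close> holding those of \<open>D (e i)\<close>. The first clause comes from products of
  distinct basis vectors, which are zero; the second from squares, and says that row
  \<open>i\<close> of \<open>A ** M\<close> is \<open>2 * M $ i $ i\<close> times row
  \<open>i\<close> of \<open>A\<close>.\<close>

definition derivation_matrix :: "'k::comm_ring_1^'n^'n \<Rightarrow> 'k^'n^'n \<Rightarrow> bool" where
  "derivation_matrix A M \<longleftrightarrow>
    (\<forall>i j k. i \<noteq> j \<longrightarrow> M $ i $ j * A $ j $ k + M $ j $ i * A $ i $ k = 0) \<and>
    (\<forall>i k. (\<Sum>l\<in>UNIV. A $ i $ l * M $ l $ k) = 2 * M $ i $ i * A $ i $ k)"

context nonassoc_algebra
begin

lemma linear_map_iff:
  "Vector_Spaces.linear scale scale f \<longleftrightarrow>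
    (\<forall>x y. f (x + y) = f x + f y) \<and> (\<forall>c x. f (c *s x) = c *s f x)"
  unfolding Vector_Spaces.linear_iff_module_hom Modules.module_hom_iff
  by (simp add: module_axioms)

lemma mult_scale_left: "(c *s u) \<bullet>\<^sub>E v = c *s (u \<bullet>\<^sub>E v)"
  using linear_map_scale[OF linear_mult_left] .

lemma mult_scale_right: "u \<bullet>\<^sub>E (c *s v) = c *s (u \<bullet>\<^sub>E v)"
  using linear_map_scale[OF linear_mult_right] .

lemma mult_sum_left:
  "(\<Sum>i\<in>I. c i *s f i) \<bullet>\<^sub>E v = (\<Sum>i\<in>I. c i *s (f i \<bullet>\<^sub>E v))"
  by (simp add: linear_map_sum[OF linear_mult_left] mult_scale_left)

lemma mult_sum_right:
  "v \<bullet>\<^sub>E (\<Sum>i\<in>I. c i *s f i) = (\<Sum>i\<in>I. c i *s (v \<bullet>\<^sub>E f i))"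
  by (simp add: linear_map_sum[OF linear_mult_right] mult_scale_right)

lemma mult_add_left: "(u + u') \<bullet>\<^sub>E v = u \<bullet>\<^sub>E v + u' \<bullet>\<^sub>E v"
  using linear_map_add[OF linear_mult_left] .

lemma mult_add_right: "u \<bullet>\<^sub>E (v + v') = u \<bullet>\<^sub>E v + u \<bullet>\<^sub>E v'"
  using linear_map_add[OF linear_mult_right] .

lemma representation_sum_basis:
  fixes e :: "'n::finite \<Rightarrow> 'v"
  assumes "natural_basis e"
  shows "representation (range e) (\<Sum>k\<in>UNIV. c k *s e k) (e j) = c j"
proof -
  have *: "inj e" "independent (range e)" "span (range e) = UNIV"
    using assms by (auto simp: natural_basis_def)
  have "representation (range e) (\<Sum>k\<in>UNIV. c k *s e k) (e j) =
      (\<Sum>k\<in>UNIV. c k * representation (range e) (e k) (e j))"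
    using * by (simp add: representation_sum representation_scale)
  also have "\<dots> = (\<Sum>k\<in>UNIV. c k * (if k = j then 1 else 0))"
    using * by (intro sum.cong) (auto simp: representation_basis inj_eq)
  finally show ?thesis by (simp add: if_distrib cong: if_cong)
qed

lemma sum_basis_eq_iff:
  fixes e :: "'n::finite \<Rightarrow> 'v"
  assumes "natural_basis e"
  shows "(\<Sum>k\<in>UNIV. c k *s e k) = (\<Sum>k\<in>UNIV. d k *s e k) \<longleftrightarrow> (\<forall>k. c k = d k)"
  using representation_sum_basis[OF assms] by (metis (no_types, lifting) sum.cong)

lemma linear_eq_on_basis:
  fixes e :: "'n::finite \<Rightarrow> 'v"
  assumes "natural_basis e" "Vector_Spaces.linear scale scale f" "Vector_Spaces.linear scale scale g"
    and "\<And>i. f (e i) = g (e i)"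
  shows "f = g"
proof
  fix x
  have x: "x = (\<Sum>k\<in>UNIV. representation (range e) x (e k) *s e k)"
    using sum_basis_coordinates[OF assms(1)] by simp
  show "f x = g x"
    by (subst (1 2) x) (simp add: linear_map_sum[OF assms(2)] linear_map_sum[OF assms(3)]
        linear_map_scale[OF assms(2)] linear_map_scale[OF assms(3)] assms(4))
qed

section \<open>Derivations as solutions of a matrix system\<close>

text \<open>Both sides of the Leibniz rule are linear in each argument separately, so
  \<open>linear_eq_on_basis\<close> extends agreement from the basis to all vectors, first in the
  left argument and then in the right one.\<close>

lemma derivation_iff_basis:
  fixes e :: "'n::finite \<Rightarrow> 'v"
  assumes e: "natural_basis e" and D: "Vector_Spaces.linear scale scale D"
  shows "derivation D \<longleftrightarrow> (\<forall>i j. D (e i \<bullet>\<^sub>E e j) = D (e i) \<bullet>\<^sub>E e j + e i \<bullet>\<^sub>E D (e j))"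
    (is "_ \<longleftrightarrow> (\<forall>i j. ?P (e i) (e j))")
proof
  assume *: "\<forall>i j. ?P (e i) (e j)"
  note simps = linear_map_add[OF D] linear_map_scale[OF D]
    mult_add_left mult_add_right mult_scale_left mult_scale_right
  have linear: "Vector_Spaces.linear scale scale (\<lambda>u. D (u \<bullet>\<^sub>E v))"
      "Vector_Spaces.linear scale scale (\<lambda>v. D (u \<bullet>\<^sub>E v))"
      "Vector_Spaces.linear scale scale (\<lambda>u. D u \<bullet>\<^sub>E v + u \<bullet>\<^sub>E D v)"
      "Vector_Spaces.linear scale scale (\<lambda>v. D u \<bullet>\<^sub>E v + u \<bullet>\<^sub>E D v)" for u v
    by (simp_all add: linear_map_iff simps scale_right_distrib add_ac)
  have "?P u (e j)" for u j
    by (rule fun_cong[OF linear_eq_on_basis[OF e linear(1)[of "e j"] linear(3)[of "e j"]]]) (use * in blast)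
  then have "?P u v" for u v
    by (rule fun_cong[OF linear_eq_on_basis[OF e linear(2)[of u] linear(4)[of u]]])
  with D show "derivation D"
    by (simp add: derivation_def)
qed (simp add: derivation_def)

text \<open>Ensures that every solution of the matrix system is realised by a map, so that families
  of derivations can be described by an equality of sets and not just an inclusion.\<close>

lemma ex_linear_map_matrix:
  fixes e :: "'n::finite \<Rightarrow> 'v" and M :: "'k^'n^'n"
  assumes e: "natural_basis e"
  shows "\<exists>D. Vector_Spaces.linear scale scale D \<and> map_matrix e D = M"
proof -
  \<comment> \<open>The coordinate row of \<open>x\<close> is multiplied by \<open>M\<close> from
    the right.\<close>
  define D where "D x = (\<Sum>i\<in>UNIV. representation (range e) x (e i) *s (\<Sum>j\<in>UNIV. M $ i $ j *s e j))" for x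
  have *: "inj e" "independent (range e)" "span (range e) = UNIV"
    using assms by (auto simp: natural_basis_def)
  have "Vector_Spaces.linear scale scale D"
    unfolding linear_map_iff D_def using *
    by (simp add: representation_add representation_scale scale_left_distrib sum.distrib
        scale_sum_right distrib_right mult.assoc)
  moreover have "D (e i) = (\<Sum>j\<in>UNIV. M $ i $ j *s e j)" for i
  proof -
    have "representation (range e) (e i) (e k) = (if k = i then 1 else 0)" for k
      using * by (auto simp: representation_basis inj_eq)
    then show ?thesis
      by (simp add: D_def if_distrib[of "\<lambda>c. c *s _"] cong: if_cong)
  qed
  then have "map_matrix e D = M"
    by (simp add: map_matrix_def vec_eq_iff representation_sum_basis[OF e])
  ultimately show ?thesis by blast
qed

text \<open>Since distinct basis vectors multiply to zero, \<open>D (e i)\<close> times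
  \<open>e j\<close> only sees the \<open>j\<close>-th coordinate of \<open>D (e i)\<close>.
  Expanding all products in the basis and comparing coefficients gives the system.\<close>

lemma derivation_iff_matrix:
  fixes e :: "'n::finite \<Rightarrow> 'v"
  assumes e: "natural_basis e" and D: "Vector_Spaces.linear scale scale D"
  shows "derivation D \<longleftrightarrow> derivation_matrix (structural_matrix e) (map_matrix e D)"
proof -
  define A where "A = structural_matrix e"
  define M where "M = map_matrix e D"
  \<comment> \<open>The conditional right-hand side lets a sum over the basis collapse to a single
    term.\<close>
  have orth: "e i \<bullet>\<^sub>E e j = (if i = j then e i \<bullet>\<^sub>E e i else 0)" for i j
    using e by (auto simp: natural_basis_def)
  have sq: "e i \<bullet>\<^sub>E e i = (\<Sum>k\<in>UNIV. A $ i $ k *s e k)" for i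
    using natural_basis_square[OF e] by (simp add: A_def)
  have De: "D (e i) = (\<Sum>j\<in>UNIV. M $ i $ j *s e j)" for i
    using map_matrix_apply[OF e] by (simp add: M_def)
  have 1: "D (e i) \<bullet>\<^sub>E e j + e i \<bullet>\<^sub>E D (e j) =
      (\<Sum>k\<in>UNIV. (M $ i $ j * A $ j $ k + M $ j $ i * A $ i $ k) *s e k)" for i j
  proof -
    have "D (e i) \<bullet>\<^sub>E e j = M $ i $ j *s (e j \<bullet>\<^sub>E e j)"
      unfolding De mult_sum_left
      by (subst orth) (simp add: if_distrib[of "\<lambda>c. _ *s c"] cong: if_cong)
    moreover have "e i \<bullet>\<^sub>E D (e j) = M $ j $ i *s (e i \<bullet>\<^sub>E e i)"
      unfolding De mult_sum_right
      by (subst orth) (simp add: if_distrib[of "\<lambda>c. _ *s c"] cong: if_cong)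
    ultimately show ?thesis
      by (simp add: sq scale_sum_right scale_left_distrib sum.distrib)
  qed
  have 2: "D (e i \<bullet>\<^sub>E e j) = (\<Sum>k\<in>UNIV. (if i = j then \<Sum>l\<in>UNIV. A $ i $ l * M $ l $ k else 0) *s e k)"
    for i j
  proof (cases "i = j")
    case True
    have "D (e i \<bullet>\<^sub>E e i) = (\<Sum>l\<in>UNIV. \<Sum>k\<in>UNIV. (A $ i $ l * M $ l $ k) *s e k)"
      by (simp add: sq linear_map_sum[OF D] linear_map_scale[OF D] De scale_sum_right)
    also have "\<dots> = (\<Sum>k\<in>UNIV. (\<Sum>l\<in>UNIV. A $ i $ l * M $ l $ k) *s e k)"
      by (subst sum.swap) (simp add: scale_sum_left)
    finally show ?thesis using True by simp
  next
    case False
    \<comment> \<open>The product is zero, and homogeneity at the scalar 0 gives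
      \<open>D 0 = 0\<close>.\<close>
    then show ?thesis
      using linear_map_scale[OF D, of 0] by (subst orth) simp
  qed
  have "derivation D \<longleftrightarrow> (\<forall>i j k. (if i = j then \<Sum>l\<in>UNIV. A $ i $ l * M $ l $ k else 0) =
      M $ i $ j * A $ j $ k + M $ j $ i * A $ i $ k)" (is "_ \<longleftrightarrow> ?R")
    unfolding derivation_iff_basis[OF e D] 1 2 sum_basis_eq_iff[OF e] ..
  also have "?R \<longleftrightarrow> derivation_matrix A M"
    unfolding derivation_matrix_def
  proof (intro iffI conjI allI impI)
    fix i j k
    assume R: ?R
    show "M $ i $ j * A $ j $ k + M $ j $ i * A $ i $ k = 0" if "i \<noteq> j"
      using R[rule_format, of i j k] that by simp
    show "(\<Sum>l\<in>UNIV. A $ i $ l * M $ l $ k) = 2 * M $ i $ i * A $ i $ k"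
      using R[rule_format, of i i k] by simp
  next
    fix i j k
    assume "(\<forall>i j k. i \<noteq> j \<longrightarrow> M $ i $ j * A $ j $ k + M $ j $ i * A $ i $ k = 0) \<and>
      (\<forall>i k. (\<Sum>l\<in>UNIV. A $ i $ l * M $ l $ k) = 2 * M $ i $ i * A $ i $ k)"
    then show "(if i = j then \<Sum>l\<in>UNIV. A $ i $ l * M $ l $ k else 0) =
        M $ i $ j * A $ j $ k + M $ j $ i * A $ i $ k"
      by (cases "i = j") (simp, metis)
  qed
  finally show ?thesis
    unfolding A_def M_def .
qed

lemma map_matrix_derivations:
  fixes e :: "'n::finite \<Rightarrow> 'v"
  assumes e: "natural_basis e"
  shows "map_matrix e ` {D. derivation D} = Collect (derivation_matrix (structural_matrix e))"
proof (intro equalityI subsetI)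
  fix M assume "M \<in> map_matrix e ` {D. derivation D}"
  then obtain D where D: "M = map_matrix e D" "derivation D"
    by blast
  then have "Vector_Spaces.linear scale scale D"
    by (simp add: derivation_def)
  with D show "M \<in> Collect (derivation_matrix (structural_matrix e))"
    using derivation_iff_matrix[OF e] by simp
next
  fix M assume M: "M \<in> Collect (derivation_matrix (structural_matrix e))"
  obtain D where D: "Vector_Spaces.linear scale scale D" "map_matrix e D = M"
    using ex_linear_map_matrix[OF e] by blast
  with M have "derivation D"
    using derivation_iff_matrix[OF e D(1)] by simp
  with D show "M \<in> map_matrix e ` {D. derivation D}"
    by blast
qed

text \<open>A linear map is determined by its matrix, so triviality can be proved for matrices and
  carried back to maps.\<close>

lemma derivations_trivial:
  fixes e :: "'n::finite \<Rightarrow> 'v"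
  assumes e: "natural_basis e" and sub: "map_matrix e ` {D. derivation D} \<subseteq> {0}"
    and D: "derivation D"
  shows "D = (\<lambda>_. 0)"
proof (rule linear_eq_on_basis[OF e])
  show "Vector_Spaces.linear scale scale D"
    using D by (simp add: derivation_def)
  show "Vector_Spaces.linear scale scale (\<lambda>_. 0)"
    by (simp add: linear_map_iff)
  have "map_matrix e D = 0"
    using sub D by blast
  then show "D (e i) = 0" for i
    using map_matrix_apply[OF e, of D i] by simp
qed

section \<open>The annihilator in terms of zero rows\<close>

text \<open>Multiplying an annihilating \<open>x\<close> by \<open>e j\<close> leaves the
  \<open>j\<close>-th coordinate times the square of \<open>e j\<close>, so that coordinate can be
  nonzero only if row \<open>j\<close> is zero. Conversely, a basis vector with zero square kills
  every basis vector, hence everything.\<close>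

lemma annihilator_eq_span:
  fixes e :: "'n::finite \<Rightarrow> 'v"
  assumes e: "natural_basis e"
  shows "annihilator = span (e ` {i. structural_matrix e $ i = 0})" (is "_ = span (e ` ?I)")
proof (intro equalityI subsetI)
  have orth: "e i \<bullet>\<^sub>E e j = (if i = j then e i \<bullet>\<^sub>E e i else 0)" for i j
    using e by (auto simp: natural_basis_def)
  have zero: "e i \<bullet>\<^sub>E e i = 0 \<longleftrightarrow> i \<in> ?I" for i
    using sum_basis_eq_iff[OF e, of "\<lambda>k. structural_matrix e $ i $ k" "\<lambda>_. 0"]
    by (simp add: natural_basis_square[OF e] vec_eq_iff)
  {
    fix x assume x: "x \<in> annihilator"
    define c where "c i = representation (range e) x (e i)" for i
    have xc: "x = (\<Sum>i\<in>UNIV. c i *s e i)"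
      using sum_basis_coordinates[OF e] by (simp add: c_def)
    have "c j *s (e j \<bullet>\<^sub>E e j) = 0" for j
    proof -
      have "x \<bullet>\<^sub>E e j = c j *s (e j \<bullet>\<^sub>E e j)"
        unfolding xc mult_sum_left
        by (subst orth) (simp add: if_distrib[of "\<lambda>c. _ *s c"] cong: if_cong)
      with x show ?thesis by (simp add: annihilator_def)
    qed
    then have "c j = 0 \<or> j \<in> ?I" for j
      using zero by auto
    then have "c j *s e j \<in> span (e ` ?I)" for j
      by (metis imageI scale_zero_left span_base span_scale span_zero)
    then show "x \<in> span (e ` ?I)"
      unfolding xc by (intro span_sum)
  next
    fix x assume "x \<in> span (e ` ?I)"
    then show "x \<in> annihilator"
    proof (induction rule: span_induct_alt)
      case base
      show ?case
        using mult_scale_left[of 0 0] mult_scale_right[of _ 0 0] by (simp add: annihilator_def)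
    next
      case (step c b y)
      then obtain i where i: "b = e i" "i \<in> ?I" by blast
      have "e i \<bullet>\<^sub>E v = 0 \<and> v \<bullet>\<^sub>E e i = 0" for v
      proof -
        have v: "v = (\<Sum>k\<in>UNIV. representation (range e) v (e k) *s e k)"
          using sum_basis_coordinates[OF e] by simp
        have "e i \<bullet>\<^sub>E e k = 0" "e k \<bullet>\<^sub>E e i = 0" for k
          using orth[of i k] orth[of k i] zero[of i] i by (auto split: if_splits)
        then show ?thesis
          by (subst (1 2) v) (simp only: mult_sum_left mult_sum_right, simp)
      qed
      with step i show ?case
        by (simp add: annihilator_def mult_add_left mult_add_right mult_scale_left mult_scale_right)
    qed
  }
qed

lemma dim_annihilator:
  fixes e :: "'n::finite \<Rightarrow> 'v"
  assumes e: "natural_basis e"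
  shows "dim annihilator = card {i. structural_matrix e $ i = 0}"
proof -
  have "inj e" "independent (range e)"
    using e by (auto simp: natural_basis_def)
  then have "independent (e ` {i. structural_matrix e $ i = 0})"
    by (meson independent_mono image_mono subset_UNIV)
  then show ?thesis
    using \<open>inj e\<close> by (simp add: annihilator_eq_span[OF e] dim_eq_card_independent card_image inj_on_subset[of e UNIV])
qed

section \<open>Permuting and rescaling a natural basis\<close>

text \<open>Squaring produces \<open>c * c\<close>, and one factor is absorbed by the new basis
  vectors, so the matrix is multiplied by \<open>c\<close> only. The scalar is the same for all
  indices because scalars varying with the index would in general destroy skew-symmetry.\<close>

lemma natural_basis_rescale_permute:
  fixes e :: "'n::finite \<Rightarrow> 'v" and p :: "'n \<Rightarrow> 'n"
  assumes e: "natural_basis e" and p: "bij p" and c: "c \<noteq> 0"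
  defines "e' \<equiv> \<lambda>i. c *s e (p i)"
  shows "natural_basis e'"
    and "structural_matrix e' = (\<chi> i k. c * structural_matrix e $ p i $ p k)"
proof -
  have *: "inj e" "independent (range e)" "span (range e) = UNIV"
    using assms by (auto simp: natural_basis_def)
  have range: "range e' = (\<lambda>v. c *s v) ` range e"
    using bij_is_surj[OF p] unfolding e'_def by (metis (no_types) image_image)
  have inj: "inj e'"
    using * p c by (auto simp: e'_def inj_def bij_def)
  have "span (range e') = UNIV"
  proof -
    have "e i \<in> span (range e')" for i
    proof -
      have "e i = inverse c *s (c *s e i)"
        using c by simp
      then show ?thesis
        unfolding range by (metis image_eqI rangeI span_base span_scale)
    qed
    then have "span (range e) \<subseteq> span (range e')"
      by (intro span_minimal) auto
    with * show ?thesis by blast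
  qed
  moreover have "independent (range e')"
  proof -
    \<comment> \<open>Independence follows by counting: a spanning set with no more elements than
      the dimension is independent.\<close>
    interpret finite_dimensional_vector_space scale "range e"
      using * by unfold_locales auto
    have "card (range e') \<le> dim UNIV"
      using * inj dim_span_eq_card_independent[OF *(2)] by (simp add: card_image)
    then show ?thesis
      using card_le_dim_spanning[of "range e'" UNIV] \<open>span (range e') = UNIV\<close> by auto
  qed
  ultimately show nb: "natural_basis e'"
    using e inj p unfolding natural_basis_def
    by (auto simp: e'_def mult_scale_left mult_scale_right bij_def inj_eq)
  have "e' i \<bullet>\<^sub>E e' i = (\<Sum>k\<in>UNIV. (c * structural_matrix e $ p i $ p k) *s e' k)" for i
  proof -
    have "e' i \<bullet>\<^sub>E e' i = (\<Sum>k\<in>UNIV. (c * c * structural_matrix e $ p i $ k) *s e k)"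
      by (simp add: e'_def mult_scale_left mult_scale_right natural_basis_square[OF e] scale_sum_right mult.assoc)
    also have "\<dots> = (\<Sum>k\<in>UNIV. (c * c * structural_matrix e $ p i $ p k) *s e (p k))"
      by (rule sum.reindex_bij_betw[OF p, symmetric])
    finally show ?thesis
      by (simp add: e'_def mult_ac)
  qed
  then show "structural_matrix e' = (\<chi> i k. c * structural_matrix e $ p i $ p k)"
    by (simp add: structural_matrix_def[of e'] vec_eq_iff representation_sum_basis[OF nb])
qed

end

section \<open>Skew-symmetric matrices and reduction to normal form\<close>

lemma skew_symmetric_nth:
  fixes A :: "'k::comm_ring_1^'n^'n"
  assumes "transpose A = - A"
  shows "A $ i $ j = - A $ j $ i"
  using arg_cong[OF assms, of "\<lambda>M. M $ j $ i"] by (simp add: transpose_def)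

text \<open>A diagonal entry equals its own negative, and 2 is invertible in characteristic
  zero.\<close>

lemma skew_symmetric_diag:
  fixes A :: "'k::field_char_0^'n^'n"
  assumes "transpose A = - A"
  shows "A $ i $ i = 0"
  using skew_symmetric_nth[OF assms, of i i] by simp

lemma skew_symmetric_rescale_permute:
  fixes A :: "'k::comm_ring_1^'n^'n"
  assumes "transpose A = - A"
  shows "transpose (\<chi> i k. c * A $ p i $ p k) = - (\<chi> i k. c * A $ p i $ p k)"
proof (unfold vec_eq_iff, intro allI)
  fix i k
  show "transpose (\<chi> i k. c * A $ p i $ p k) $ i $ k = (- (\<chi> i k. c * A $ p i $ p k)) $ i $ k"
    using skew_symmetric_nth[OF assms, of "p k" "p i"] by (simp add: transpose_def)
qed

lemma (in volterra_evolution_algebra) rescale_permute: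
  fixes p :: "'n \<Rightarrow> 'n"
  assumes "bij p" and "c \<noteq> 0"
  shows "volterra_evolution_algebra scale mult (\<lambda>i. c *s e (p i))"
proof unfold_locales
  note nb = natural_basis_rescale_permute[OF natural_basis assms]
  show "natural_basis (\<lambda>i. c *s e (p i))"
    by (rule nb(1))
  show "transpose (structural_matrix (\<lambda>i. c *s e (p i))) = - structural_matrix (\<lambda>i. c *s e (p i))"
    unfolding nb(2) by (rule skew_symmetric_rescale_permute[OF skew_symmetric])
qed

text \<open>By skew-symmetry the entry above the diagonal decides whether a pair is
  connected.\<close>

lemma connected_pairs_3:
  fixes A :: "'k::field^3^3"
  assumes "transpose A = - A"
  shows "connected_pairs A = (if A $ 1 $ 2 = 0 then {} else {{1, 2}}) \<union>
    (if A $ 1 $ 3 = 0 then {} else {{1, 3}}) \<union> (if A $ 2 $ 3 = 0 then {} else {{2, 3}})"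
proof -
  have exists_3: "(\<exists>i::3. P i) \<longleftrightarrow> P 1 \<or> P 2 \<or> P 3" for P
    using forall_3[of "\<lambda>i. \<not> P i"] by blast
  show ?thesis
    unfolding connected_pairs_def graph_edges_def
    using skew_symmetric_nth[OF assms, of 2 1] skew_symmetric_nth[OF assms, of 3 1]
      skew_symmetric_nth[OF assms, of 3 2]
    by (auto simp: exists_3 insert_commute)
qed

lemma volterra_case2_intro:
  fixes A :: "'k::field_char_0^3^3"
  assumes skew: "transpose A = - A" and "A $ 1 $ 2 = 1" "A $ 1 $ 3 \<noteq> 0" "A $ 2 $ 3 = 0"
  shows "volterra_case2 (A $ 1 $ 3) A"
  using assms connected_pairs_3[OF skew] skew_symmetric_diag[OF skew]
    skew_symmetric_nth[OF skew, of 2 1] skew_symmetric_nth[OF skew, of 3 1]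
    skew_symmetric_nth[OF skew, of 3 2]
  by (auto simp: volterra_case2_def vec_eq_iff forall_3)

text \<open>The cases follow the number of edges. Three edges are already complete; two edges share
  a vertex, which is moved to position 1; a single edge is moved to \<open>{1, 2}\<close>. In the
  last two cases the inverse of the entry at positions 1 and 2 serves as \<open>c\<close>, which
  makes this entry 1 and also absorbs signs.\<close>

lemma volterra_normal_form:
  fixes A :: "'k::field_char_0^3^3"
  assumes skew: "transpose A = - A" and "A \<noteq> 0"
  obtains p :: "3 \<Rightarrow> 3" and c where "bij p" and "c \<noteq> 0"
    and "volterra_case1 (\<chi> i k. c * A $ p i $ p k) \<or>
      (\<exists>a. volterra_case2 a (\<chi> i k. c * A $ p i $ p k)) \<or>
      volterra_case3 (\<chi> i k. c * A $ p i $ p k)"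
proof -
  note skew_entries = skew_symmetric_diag[OF skew] skew_symmetric_nth[OF skew, of 2 1]
    skew_symmetric_nth[OF skew, of 3 1] skew_symmetric_nth[OF skew, of 3 2]
  define B where "B p c = (\<chi> i k. c * A $ p i $ p k)" for p :: "3 \<Rightarrow> 3" and c
  have B: "B p c $ i $ k = c * A $ p i $ p k" for p c i k
    by (simp add: B_def)
  have skewB: "transpose (B p c) = - B p c" for p c
    unfolding B_def by (rule skew_symmetric_rescale_permute[OF skew])
  let ?G = "\<exists>p c. bij p \<and> c \<noteq> 0 \<and>
    (volterra_case1 (B p c) \<or> (\<exists>a. volterra_case2 a (B p c)) \<or> volterra_case3 (B p c))"
  \<comment> \<open>Here \<open>p 1\<close> is the vertex common to both edges.\<close>
  have case2: ?G
    if "bij p" "A $ p 1 $ p 2 \<noteq> 0" "A $ p 1 $ p 3 \<noteq> 0" "A $ p 2 $ p 3 = 0" for p :: "3 \<Rightarrow> 3"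
  proof (intro exI conjI)
    let ?B = "B p (inverse (A $ p 1 $ p 2))"
    have "volterra_case2 (?B $ 1 $ 3) ?B"
      using that by (intro volterra_case2_intro skewB) (simp_all add: B)
    then show "volterra_case1 ?B \<or> (\<exists>a. volterra_case2 a ?B) \<or> volterra_case3 ?B"
      by blast
  qed (use that in simp_all)
  have case3: ?G
    if "bij p" "A $ p 1 $ p 2 \<noteq> 0" "A $ p 1 $ p 3 = 0" "A $ p 2 $ p 3 = 0" for p :: "3 \<Rightarrow> 3"
  proof (intro exI conjI)
    let ?B = "B p (inverse (A $ p 1 $ p 2))"
    have "volterra_case3 ?B"
      using that unfolding volterra_case3_def connected_pairs_3[OF skewB] by (simp add: B)
    then show "volterra_case1 ?B \<or> (\<exists>a. volterra_case2 a ?B) \<or> volterra_case3 ?B"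
      by blast
  qed (use that in simp_all)
  \<comment> \<open>Transpositions are the only permutations required besides the identity.\<close>
  have bij: "bij (id(i := j, j := i))" for i j :: 3
    by (rule involuntory_imp_bij) auto
  have nz: "A $ 1 $ 2 \<noteq> 0 \<or> A $ 1 $ 3 \<noteq> 0 \<or> A $ 2 $ 3 \<noteq> 0"
    using \<open>A \<noteq> 0\<close> skew_entries by (auto simp: vec_eq_iff forall_3)
  have ?G
  proof (cases "A $ 1 $ 2 \<noteq> 0 \<and> A $ 1 $ 3 \<noteq> 0 \<and> A $ 2 $ 3 \<noteq> 0")
    case True
    then have "volterra_case1 (B id 1)"
      by (simp add: volterra_case1_def complete_graph_3_iff[OF skewB] B)
    then show ?thesis
      by (intro exI[of _ id] exI[of _ "1::'k"]) simp
  next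
    case False
    \<comment> \<open>Of the eight zero patterns, \<open>nz\<close> rules out the empty graph and
      \<open>False\<close> the complete one.\<close>
    with nz consider
      "A $ 1 $ 2 \<noteq> 0" "A $ 1 $ 3 \<noteq> 0" "A $ 2 $ 3 = 0" | "A $ 1 $ 2 \<noteq> 0" "A $ 1 $ 3 = 0" "A $ 2 $ 3 \<noteq> 0"
      | "A $ 1 $ 2 = 0" "A $ 1 $ 3 \<noteq> 0" "A $ 2 $ 3 \<noteq> 0" | "A $ 1 $ 2 \<noteq> 0" "A $ 1 $ 3 = 0" "A $ 2 $ 3 = 0"
      | "A $ 1 $ 2 = 0" "A $ 1 $ 3 \<noteq> 0" "A $ 2 $ 3 = 0" | "A $ 1 $ 2 = 0" "A $ 1 $ 3 = 0" "A $ 2 $ 3 \<noteq> 0"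
      by blast
    then show ?thesis
    proof cases
      case 1
      show ?thesis
        by (rule case2[OF bij_id]) (use 1 in simp_all)
    next
      case 2
      show ?thesis
        by (rule case2[OF bij[of 1 2]]) (use 2 skew_entries in simp_all)
    next
      case 3
      show ?thesis
        by (rule case2[OF bij[of 1 3]]) (use 3 skew_entries in simp_all)
    next
      case 4
      show ?thesis
        by (rule case3[OF bij_id]) (use 4 in simp_all)
    next
      case 5
      show ?thesis
        by (rule case3[OF bij[of 2 3]]) (use 5 skew_entries in simp_all)
    next
      case 6
      show ?thesis
        by (rule case3[OF bij[of 1 3]]) (use 6 skew_entries in simp_all)
    qed
  qed
  then show thesis
    using that unfolding B_def by blast
qed

section \<open>Solving the derivation system in the three normal forms\<close>

text \<open>Along every edge the off-diagonal entries of \<open>M\<close> vanish, and each diagonal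
  entry is twice the one at the other end. Going back and forth along an edge gives
  \<open>m = 4 * m\<close>, hence \<open>m = 0\<close> in characteristic zero.\<close>

lemma derivation_matrix_case1:
  fixes A M :: "'k::field_char_0^3^3"
  assumes skew: "transpose A = - A" and "volterra_case1 A" and M: "derivation_matrix A M"
  shows "M = 0"
proof -
  have nz: "A $ 1 $ 2 \<noteq> 0" "A $ 1 $ 3 \<noteq> 0" "A $ 2 $ 3 \<noteq> 0"
    using assms by (simp_all add: volterra_case1_def complete_graph_3_iff)
  note skew_entries = skew_symmetric_diag[OF skew] skew_symmetric_nth[OF skew, of 2 1]
    skew_symmetric_nth[OF skew, of 3 1] skew_symmetric_nth[OF skew, of 3 2]
  have pair: "M $ i $ j * A $ j $ k + M $ j $ i * A $ i $ k = 0" if "i \<noteq> j" for i j k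
    using M that by (simp add: derivation_matrix_def)
  have row: "A $ i $ 1 * M $ 1 $ k + A $ i $ 2 * M $ 2 $ k + A $ i $ 3 * M $ 3 $ k = 2 * M $ i $ i * A $ i $ k"
    for i k
    using M by (simp add: derivation_matrix_def sum_3)
  \<comment> \<open>Taking \<open>k\<close> to be \<open>i\<close> or \<open>j\<close> isolates one
    unknown, because the diagonal of \<open>A\<close> is zero.\<close>
  have off: "M $ 1 $ 2 = 0" "M $ 2 $ 1 = 0" "M $ 1 $ 3 = 0" "M $ 3 $ 1 = 0" "M $ 2 $ 3 = 0" "M $ 3 $ 2 = 0"
    using pair[of 1 2 1] pair[of 1 2 2] pair[of 1 3 1] pair[of 1 3 3] pair[of 2 3 2] pair[of 2 3 3]
      nz skew_entries by simp_all
  have "M $ 2 $ 2 = 2 * M $ 1 $ 1" "M $ 1 $ 1 = 2 * M $ 2 $ 2" "M $ 3 $ 3 = 2 * M $ 1 $ 1"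
    using row[of 1 2] row[of 2 1] row[of 1 3] off nz skew_entries by (simp_all add: mult.commute)
  then have "M $ 1 $ 1 = 0" "M $ 2 $ 2 = 0" "M $ 3 $ 3 = 0"
    by simp_all
  with off show ?thesis
    by (simp add: vec_eq_iff forall_3)
qed

text \<open>This makes the dichotomy of the theorem explicit: nonzero derivations exist exactly when
  \<open>a ^ 3 = -1\<close>. The first row of the system yields two expressions for the entries
  linking vertices 2 and 3, and they are compatible only if
  \<open>\<alpha> * (a ^ 3 + 1) = 0\<close>.\<close>

lemma derivation_matrix_case2:
  fixes A M :: "'k::field_char_0^3^3"
  assumes A: "volterra_case2 a A"
  shows "derivation_matrix A M \<longleftrightarrow>
    (\<exists>\<alpha>. (a ^ 3 = -1 \<or> \<alpha> = 0) \<and>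
      M = vector [vector [2 * \<alpha>, 0, 0],
                  vector [0, \<alpha>, 3 * a * \<alpha>],
                  vector [0, - 3 * a ^ 2 * \<alpha>, \<alpha>]])"
    (is "_ \<longleftrightarrow> (\<exists>\<alpha>. _ \<and> M = ?N \<alpha>)")
proof
  have a: "a \<noteq> 0" and A_eq: "A = vector [vector [0, 1, a], vector [-1, 0, 0], vector [-a, 0, 0]]"
    using A by (simp_all add: volterra_case2_def)
  {
    assume M: "derivation_matrix A M"
    have pair: "M $ i $ j * A $ j $ k + M $ j $ i * A $ i $ k = 0" if "i \<noteq> j" for i j k
      using M that by (simp add: derivation_matrix_def)
    have row: "A $ i $ 1 * M $ 1 $ k + A $ i $ 2 * M $ 2 $ k + A $ i $ 3 * M $ 3 $ k = 2 * M $ i $ i * A $ i $ k"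
      for i k
      using M by (simp add: derivation_matrix_def sum_3)
    define \<alpha> where "\<alpha> = M $ 2 $ 2"
    have off: "M $ 1 $ 2 = 0" "M $ 2 $ 1 = 0" "M $ 1 $ 3 = 0" "M $ 3 $ 1 = 0"
      using pair[of 1 2 1] pair[of 1 2 2] pair[of 1 3 1] pair[of 1 3 2] a by (simp_all add: A_eq)
    have diag: "M $ 1 $ 1 = 2 * \<alpha>" "M $ 3 $ 3 = \<alpha>"
      using row[of 2 1] row[of 3 1] a by (simp_all add: A_eq \<alpha>_def)
    \<comment> \<open>Vertices 2 and 3 are not connected, but both squares are multiples of
      \<open>e 1\<close>; the pair equation therefore relates the two entries without forcing them
      to be zero.\<close>
    have m32: "M $ 3 $ 2 = - a * M $ 2 $ 3"
      using pair[of 2 3 1] by (simp add: A_eq mult.commute)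
    have m23: "M $ 2 $ 3 = 3 * a * \<alpha>"
      using row[of 1 3] diag by (simp add: A_eq algebra_simps)
    have "\<alpha> + a * M $ 3 $ 2 = 4 * \<alpha>"
      using row[of 1 2] diag by (simp add: A_eq \<alpha>_def)
    then have "3 * (\<alpha> * (a ^ 3 + 1)) = 0"
      unfolding m32 m23 by algebra
    then have "\<alpha> = 0 \<or> a ^ 3 = -1"
      by (auto simp: add_eq_0_iff2)
    moreover have "M = ?N \<alpha>"
      using off diag m23 m32 by (simp add: vec_eq_iff forall_3 \<alpha>_def power2_eq_square mult_ac)
    ultimately show "\<exists>\<alpha>. (a ^ 3 = -1 \<or> \<alpha> = 0) \<and> M = ?N \<alpha>"
      by blast
  next
    assume "\<exists>\<alpha>. (a ^ 3 = -1 \<or> \<alpha> = 0) \<and> M = ?N \<alpha>"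
    then obtain \<alpha> where \<alpha>: "a ^ 3 = -1 \<or> \<alpha> = 0" and M: "M = ?N \<alpha>"
      by blast
    \<comment> \<open>This is the equation for row 1 and column 2, the only one that depends on the
      condition on \<open>a\<close>; the others are identities in \<open>a\<close> and
      \<open>\<alpha>\<close>.\<close>
    have "\<alpha> - a * (3 * a ^ 2 * \<alpha>) = 4 * \<alpha>"
      using \<alpha> by algebra
    then show "derivation_matrix A M"
      by (simp add: derivation_matrix_def A_eq M forall_3 sum_3 algebra_simps power2_eq_square)
  }
qed

text \<open>Row and column 3 of \<open>A\<close> are zero, so \<open>M $ 3 $ 3\<close> drops out of
  every equation and is the free parameter. The edge \<open>{1, 2}\<close> eliminates its own block
  as in the complete case.\<close>

lemma derivation_matrix_case3:
  fixes A M :: "'k::field_char_0^3^3"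
  assumes skew: "transpose A = - A" and "volterra_case3 A"
  shows "derivation_matrix A M \<longleftrightarrow>
    (\<exists>\<alpha>. M = vector [vector [0, 0, 0], vector [0, 0, 0], vector [0, 0, \<alpha>]])"
    (is "_ \<longleftrightarrow> (\<exists>\<alpha>. M = ?N \<alpha>)")
proof
  have A: "A $ 1 $ 2 = 1" "A $ 1 $ 3 = 0" "A $ 2 $ 3 = 0" "A $ 2 $ 1 = -1" "A $ 3 $ 1 = 0" "A $ 3 $ 2 = 0"
      "A $ i $ i = 0" for i
    using assms skew_symmetric_diag[OF skew] skew_symmetric_nth[OF skew, of 2 1]
      skew_symmetric_nth[OF skew, of 3 1] skew_symmetric_nth[OF skew, of 3 2]
    by (auto simp: volterra_case3_def)
  {
    assume M: "derivation_matrix A M"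
    have pair: "M $ i $ j * A $ j $ k + M $ j $ i * A $ i $ k = 0" if "i \<noteq> j" for i j k
      using M that by (simp add: derivation_matrix_def)
    have row: "A $ i $ 1 * M $ 1 $ k + A $ i $ 2 * M $ 2 $ k + A $ i $ 3 * M $ 3 $ k = 2 * M $ i $ i * A $ i $ k"
      for i k
      using M by (simp add: derivation_matrix_def sum_3)
    \<comment> \<open>The pair equations do not determine the first two entries of column 3; these
      come from the row equations for rows 1 and 2.\<close>
    have off: "M $ 1 $ 2 = 0" "M $ 2 $ 1 = 0" "M $ 3 $ 1 = 0" "M $ 3 $ 2 = 0" "M $ 2 $ 3 = 0" "M $ 1 $ 3 = 0"
      using pair[of 1 2 1] pair[of 1 2 2] pair[of 1 3 2] pair[of 2 3 1] row[of 1 3] row[of 2 3]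
      by (simp_all add: A)
    have "M $ 2 $ 2 = 2 * M $ 1 $ 1" "M $ 1 $ 1 = 2 * M $ 2 $ 2"
      using row[of 1 2] row[of 2 1] by (simp_all add: A)
    then have "M $ 1 $ 1 = 0" "M $ 2 $ 2 = 0"
      by simp_all
    with off have "M = ?N (M $ 3 $ 3)"
      by (simp add: vec_eq_iff forall_3)
    then show "\<exists>\<alpha>. M = ?N \<alpha>" ..
  next
    assume "\<exists>\<alpha>. M = ?N \<alpha>"
    then show "derivation_matrix A M"
      by (auto simp: derivation_matrix_def forall_3 sum_3 A)
  }
qed

text \<open>Combined with \<open>dim_annihilator\<close>, this gives the dimensions 0, 0 and 1. A
  row vanishes exactly when its vertex is isolated.\<close>

lemma zero_rows_3:
  fixes A :: "'k::field_char_0^3^3"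
  assumes skew: "transpose A = - A"
  shows "volterra_case1 A \<Longrightarrow> {i. A $ i = 0} = {}"
    and "volterra_case2 a A \<Longrightarrow> {i. A $ i = 0} = {}"
    and "volterra_case3 A \<Longrightarrow> {i. A $ i = 0} = {3}"
proof -
  note skew_entries = skew_symmetric_diag[OF skew] skew_symmetric_nth[OF skew, of 2 1]
    skew_symmetric_nth[OF skew, of 3 1] skew_symmetric_nth[OF skew, of 3 2]
  have eq: "{i. A $ i = 0} = S \<longleftrightarrow> (\<forall>i. (\<forall>k. A $ i $ k = 0) \<longleftrightarrow> i \<in> S)" for S
    by (auto simp: set_eq_iff vec_eq_iff)
  show "volterra_case1 A \<Longrightarrow> {i. A $ i = 0} = {}"
    using skew_entries by (simp add: eq forall_3 volterra_case1_def complete_graph_3_iff[OF skew])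
  show "{i. A $ i = 0} = {}" if "volterra_case2 a A"
  proof -
    have "A $ 1 $ 2 = 1" "A $ 2 $ 1 = -1" "A $ 3 $ 1 = -a" "a \<noteq> 0"
      using that by (simp_all add: volterra_case2_def)
    then show ?thesis
      by (simp add: eq forall_3)
  qed
  show "volterra_case3 A \<Longrightarrow> {i. A $ i = 0} = {3}"
    using skew_entries by (simp add: eq forall_3 volterra_case3_def)
qed

section \<open>Existence of the normal form and its derivations and annihilator\<close>

theorem theorem7p5:
  fixes scale :: "'k::field_char_0 \<Rightarrow> 'v::ab_group_add \<Rightarrow> 'v"
    and mult :: "'v \<Rightarrow> 'v \<Rightarrow> 'v"
    and e\<^sub>0 :: "3 \<Rightarrow> 'v"
  defines "A \<equiv> nonassoc_algebra.structural_matrix scale mult :: (3 \<Rightarrow> 'v) \<Rightarrow> 'k^3^3"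
    and "der \<equiv> nonassoc_algebra.derivation scale mult"
    and "mat_of \<equiv> nonassoc_algebra.map_matrix scale :: (3 \<Rightarrow> 'v) \<Rightarrow> ('v \<Rightarrow> 'v) \<Rightarrow> 'k^3^3"
    and "dim_ann \<equiv> vector_space.dim scale (nonassoc_algebra.annihilator mult)"
  assumes "volterra_evolution_algebra scale mult e\<^sub>0"
    and "A e\<^sub>0 \<noteq> 0"
  shows
    "(\<exists>e :: 3 \<Rightarrow> 'v. volterra_evolution_algebra scale mult e \<and>
        (volterra_case1 (A e) \<or> (\<exists>a. volterra_case2 a (A e)) \<or> volterra_case3 (A e))) \<and>
     (\<forall>e :: 3 \<Rightarrow> 'v. volterra_evolution_algebra scale mult e \<longrightarrow>
        (volterra_case1 (A e) \<longrightarrow> (\<forall>D. der D \<longrightarrow> D = (\<lambda>_. 0)) \<and> dim_ann = 0) \<and>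
        (\<forall>a. volterra_case2 a (A e) \<longrightarrow>
           (mat_of e ` {D. der D} =
              {vector [vector [2 * \<alpha>, 0, 0],
                       vector [0, \<alpha>, 3 * a * \<alpha>],
                       vector [0, - 3 * a ^ 2 * \<alpha>, \<alpha>]] | \<alpha>. True} \<or>
            (\<forall>D. der D \<longrightarrow> D = (\<lambda>_. 0))) \<and>
           dim_ann = 0) \<and>
        (volterra_case3 (A e) \<longrightarrow>
           mat_of e ` {D. der D} =
             {vector [vector [0, 0, 0],
                      vector [0, 0, 0],
                      vector [0, 0, \<alpha>]] | \<alpha>. True} \<and>
           dim_ann = 1))"
proof (intro conjI allI impI)
  interpret E0: volterra_evolution_algebra scale mult e\<^sub>0
    by fact
  show "\<exists>e :: 3 \<Rightarrow> 'v. volterra_evolution_algebra scale mult e \<and>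
      (volterra_case1 (A e) \<or> (\<exists>a. volterra_case2 a (A e)) \<or> volterra_case3 (A e))"
  proof -
    obtain p c where pc: "bij p" "c \<noteq> 0" and
      *: "volterra_case1 (\<chi> i k. c * A e\<^sub>0 $ p i $ p k) \<or>
        (\<exists>a. volterra_case2 a (\<chi> i k. c * A e\<^sub>0 $ p i $ p k)) \<or>
        volterra_case3 (\<chi> i k. c * A e\<^sub>0 $ p i $ p k)"
      using volterra_normal_form[OF E0.skew_symmetric] \<open>A e\<^sub>0 \<noteq> 0\<close> unfolding A_def by metis
    from * have "volterra_case1 (A (\<lambda>i. scale c (e\<^sub>0 (p i)))) \<or>
        (\<exists>a. volterra_case2 a (A (\<lambda>i. scale c (e\<^sub>0 (p i))))) \<or>
        volterra_case3 (A (\<lambda>i. scale c (e\<^sub>0 (p i))))"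
      unfolding A_def E0.natural_basis_rescale_permute(2)[OF E0.natural_basis pc] .
    with E0.rescale_permute[OF pc] show ?thesis
      by (intro exI[of _ "\<lambda>i. scale c (e\<^sub>0 (p i))"] conjI)
  qed
next
  fix e :: "3 \<Rightarrow> 'v"
  assume "volterra_evolution_algebra scale mult e"
  then interpret volterra_evolution_algebra scale mult e .
  note skew = skew_symmetric[folded A_def]
  have mats: "mat_of e ` {D. der D} = Collect (derivation_matrix (A e))"
    using map_matrix_derivations[OF natural_basis] by (simp add: A_def der_def mat_of_def)
  have trivial: "D = (\<lambda>_. 0)" if "\<And>M. derivation_matrix (A e) M \<Longrightarrow> M = 0" "der D" for D
    using that derivations_trivial[OF natural_basis, of D] mats unfolding mat_of_def der_def by auto
  have dim: "dim_ann = card {i. A e $ i = 0}"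
    using dim_annihilator[OF natural_basis] by (simp add: dim_ann_def A_def)
  {
    assume case1: "volterra_case1 (A e)"
    show "D = (\<lambda>_. 0)" if "der D" for D
      by (rule trivial[OF derivation_matrix_case1[OF skew case1] that])
    show "dim_ann = 0"
      by (simp add: dim zero_rows_3(1)[OF skew case1])
  next
    fix a
    assume case2: "volterra_case2 a (A e)"
    show "mat_of e ` {D. der D} =
        {vector [vector [2 * \<alpha>, 0, 0],
                 vector [0, \<alpha>, 3 * a * \<alpha>],
                 vector [0, - 3 * a ^ 2 * \<alpha>, \<alpha>]] | \<alpha>. True} \<or>
        (\<forall>D. der D \<longrightarrow> D = (\<lambda>_. 0))"
    \<comment> \<open>If the cube condition holds, \<alpha> is unconstrained and the whole family
      occurs; otherwise \<alpha> must be 0, which leaves only the zero matrix.\<close>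
    proof (cases "a ^ 3 = -1")
      case True
      then show ?thesis
        unfolding mats derivation_matrix_case2[OF case2] by simp
    next
      case False
      then have zero: "M = 0" if "derivation_matrix (A e) M" for M
        using that by (auto simp: derivation_matrix_case2[OF case2] vec_eq_iff forall_3)
      show ?thesis
        by (intro disjI2 allI impI trivial[OF zero])
    qed
    show "dim_ann = 0"
      by (simp add: dim zero_rows_3(2)[OF skew case2])
  next
    assume case3: "volterra_case3 (A e)"
    show "mat_of e ` {D. der D} =
        {vector [vector [0, 0, 0], vector [0, 0, 0], vector [0, 0, \<alpha>]] | \<alpha>. True}"
      unfolding mats derivation_matrix_case3[OF skew case3] by simp
    show "dim_ann = 1"
      by (simp add: dim zero_rows_3(3)[OF skew case3])
  }
qed

end
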